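(* Let $X$ be a semigroup acting semiuniformly on a uniform space $Y$. Let $\Phi$ be any one of the following assignments of a subset $\Phi(Z)\subseteq\mathbf{M}(Z)$ to each uniform space $Z$: $\Phi(Z)=\mathbf{M}^+(Z)$, $\Phi(Z)=\mathbf{Mol}(Z)$, $\Phi(Z)=\mathbf{Mol}^+(Z)$, $\Phi(Z)=\mathbf{M_u}(Z)$, $\Phi(Z)=\mathbf{M_u^+}(Z)$, $\Phi(Z)=\overline{Z}$, $\Phi(Z)=\widehat{Z}$. If $\mu\in\Phi(X)$ and $\nu\in\Phi(Y)$, then $\mu\star\nu\in\Phi(Y)$.
   Context: All uniform spaces are Hausdorff, all linear spaces are over $\mathbb{R}$. A semigroup $X$ endowed with a uniformity acts semiuniformly on a uniform space $Y$ if there is given a map $m:X\times Y\to Y$ with $m(s,m(s',y))=m(ss',y)$ for all $s,s'\in X$, $y\in Y$, that is uniformly continuous from Isbell's semiuniform product $X * Y$ to $Y$, i.e. such that the set of maps $\{x\mapsto m(x,y): y\in Y\}$ from $X$ to $Y$ is uniformly equicontinuous and for each $x\in X$ the map $y\mapsto m(x,y)$ is uniformly continuous. For a uniform space $Z$: $\mathbf{U_b}(Z)$ is the space of bounded uniformly continuous real-valued functions on $Z$ with the sup norm; $\mathbf{M}(Z)$ is its norm dual; the weak* topology on $\mathbf{M}(Z)$ is the weak topology of the duality $\langle\mathbf{M}(Z),\mathbf{U_b}(Z)\rangle$. For a uniformly continuous pseudometric $\Delta$ on $Z$, $\mathrm{Lip}(\Delta)$ is the set of $f:Z\to[-1,1]$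 with $|f(z)-f(z')|\le\Delta(z,z')$ for all $z,z'$, with the topology of pointwise convergence on $Z$. $\mathbf{M_u}(Z)$ is the set of $\mu\in\mathbf{M}(Z)$ that are continuous on $\mathrm{Lip}(\Delta)$ for every uniformly continuous pseudometric $\Delta$ on $Z$. For $z\in Z$, $\delta_z\in\mathbf{M}(Z)$ is $\delta_z(f)=f(z)$; $\mathbf{Mol}(Z)$ is the linear span of $\{\delta_z: z\in Z\}$. $\overline{Z}$ is the weak* closure of $\{\delta_z:z\in Z\}$ in $\mathbf{M}(Z)$, and $\widehat{Z}=\overline{Z}\cap\mathbf{M_u}(Z)$. $\mathbf{M}^+(Z)$ is the set of $\mu\in\mathbf{M}(Z)$ with $\mu(f)\ge0$ for all $f\in\mathbf{U_b}(Z)$ with $f\ge0$; $\mathbf{Mol}^+(Z)=\mathbf{Mol}(Z)\cap\mathbf{M}^+(Z)$ and $\mathbf{M_u^+}(Z)=\mathbf{M_u}(Z)\cap\mathbf{M}^+(Z)$. Convolution: for $\mu\in\mathbf{M}(X)$, $\nu\in\mathbf{M}(Y)$ the element $\mu\star\nu\in\mathbf{M}(Y)$ is defined by $(\mu\star\nu)(f)=\mu\big(x\mapsto \nu(y\mapsto f(m(x,y)))\big)$ for $f\in\mathbf{U_b}(Y)$ (the inner function of $x$ is in $\mathbf{U_b}(X)$). *)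

theory Defs
  imports "HOL-Analysis.Analysis"
begin

section \<open>Bounded uniformly continuous functions\<close>

definition ubfun :: "('z::uniform_space \<Rightarrow> real) set"
  where "ubfun = {f. uniformly_continuous_on UNIV f \<and> bounded (range f)}"

lemma uniformly_continuous_real_iff:
  fixes f :: "'z::uniform_space \<Rightarrow> real"
  shows "uniformly_continuous_on UNIV f \<longleftrightarrow>
    (\<forall>e>0. \<forall>\<^sub>F p in uniformity. \<bar>f (fst p) - f (snd p)\<bar> < e)"
proof
  assume u: "uniformly_continuous_on UNIV f"
  show "\<forall>e>0. \<forall>\<^sub>F p in uniformity. \<bar>f (fst p) - f (snd p)\<bar> < e"
  proof (intro allI impI)
    fix e :: real assume "e > 0"
    then have "eventually (\<lambda>(x::real, y). dist x y < e) uniformity"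
      unfolding eventually_uniformity_metric by auto
    from uniformly_continuous_onD[OF u this]
    show "\<forall>\<^sub>F p in uniformity. \<bar>f (fst p) - f (snd p)\<bar> < e"
      by (simp add: dist_real_def case_prod_unfold)
  qed
next
  assume a: "\<forall>e>0. \<forall>\<^sub>F p in uniformity. \<bar>f (fst p) - f (snd p)\<bar> < e"
  show "uniformly_continuous_on UNIV f"
    unfolding uniformly_continuous_on_uniformity filterlim_iff
  proof (intro allI impI)
    fix P :: "real \<times> real \<Rightarrow> bool" assume "eventually P uniformity"
    then obtain e where e: "e > 0" "\<And>x y. dist x y < e \<Longrightarrow> P (x, y)"
      unfolding eventually_uniformity_metric by auto
    from a e(1) have "\<forall>\<^sub>F p in uniformity_on UNIV. \<bar>f (fst p) - f (snd p)\<bar> < e"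
      by simp
    then show "\<forall>\<^sub>F x in uniformity_on UNIV. P (case x of (x, y) \<Rightarrow> (f x, f y))"
    proof eventually_elim
      case (elim p)
      then show ?case using e(2)[of "f (fst p)" "f (snd p)"]
        by (simp add: dist_real_def case_prod_unfold)
    qed
  qed
qed

typedef (overloaded) ('z::uniform_space) U_b = "ubfun :: ('z \<Rightarrow> real) set"
  morphisms apply_U_b Abs_U_b
  by (rule exI[of _ "\<lambda>_. 0"]) (auto simp: ubfun_def uniformly_continuous_on_const)

setup_lifting type_definition_U_b

lemma ubfun_bound:
  assumes "f \<in> ubfun"
  obtains B where "\<And>x. \<bar>f x\<bar> \<le> B"
  using assms unfolding ubfun_def bounded_iff by auto

lemma ubfunI:
  assumes "\<And>e. e > 0 \<Longrightarrow> \<forall>\<^sub>F p in uniformity. \<bar>f (fst p) - f (snd p)\<bar> < e"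
    and "\<And>x. \<bar>f x\<bar> \<le> B"
  shows "f \<in> ubfun"
  using assms by (auto simp: ubfun_def uniformly_continuous_real_iff bounded_iff)

lemma ubfunD:
  assumes "f \<in> ubfun" "e > 0"
  shows "\<forall>\<^sub>F p in uniformity. \<bar>f (fst p) - f (snd p)\<bar> < e"
  using assms by (auto simp: ubfun_def uniformly_continuous_real_iff)

lemma ubfun_const: "(\<lambda>_. c) \<in> ubfun"
  by (rule ubfunI[where B = "\<bar>c\<bar>"]) auto

lemma ubfun_add:
  assumes f: "f \<in> ubfun" and g: "g \<in> ubfun"
  shows "(\<lambda>x. f x + g x) \<in> ubfun"
proof -
  obtain A where A: "\<And>x. \<bar>f x\<bar> \<le> A" using ubfun_bound[OF f] by blast
  obtain B where B: "\<And>x. \<bar>g x\<bar> \<le> B" using ubfun_bound[OF g] by blast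
  show ?thesis
  proof (rule ubfunI)
    show "\<bar>f x + g x\<bar> \<le> A + B" for x using A[of x] B[of x] by linarith
    fix e :: real assume "e > 0"
    then have "e / 2 > 0" by simp
    from ubfunD[OF f this] ubfunD[OF g this]
    show "\<forall>\<^sub>F p in uniformity. \<bar>f (fst p) + g (fst p) - (f (snd p) + g (snd p))\<bar> < e"
      by eventually_elim (simp only: abs_less_iff, linarith)
  qed
qed

lemma ubfun_scale:
  assumes f: "f \<in> ubfun"
  shows "(\<lambda>x. c * f x) \<in> ubfun"
proof -
  obtain A where A: "\<And>x. \<bar>f x\<bar> \<le> A" using ubfun_bound[OF f] by blast
  show ?thesis
  proof (rule ubfunI)
    show "\<bar>c * f x\<bar> \<le> \<bar>c\<bar> * A" for x
      using A[of x] by (simp add: abs_mult mult_left_mono)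
    fix e :: real assume e: "e > 0"
    then have "e / (\<bar>c\<bar> + 1) > 0" by (simp add: add_nonneg_pos)
    from ubfunD[OF f this]
    show "\<forall>\<^sub>F p in uniformity. \<bar>c * f (fst p) - c * f (snd p)\<bar> < e"
    proof eventually_elim
      case (elim p)
      then have "(\<bar>c\<bar> + 1) * \<bar>f (fst p) - f (snd p)\<bar> < e"
        by (simp add: field_simps add_nonneg_pos)
      moreover have "\<bar>c\<bar> * \<bar>f (fst p) - f (snd p)\<bar> \<le> (\<bar>c\<bar> + 1) * \<bar>f (fst p) - f (snd p)\<bar>"
        by (intro mult_right_mono) auto
      ultimately show ?case
        by (simp add: abs_mult flip: right_diff_distrib)
    qed
  qed
qed

instantiation U_b :: (uniform_space) real_vector
begin

lift_definition zero_U_b :: "'a U_b" is "\<lambda>_. 0" by (rule ubfun_const)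

lift_definition plus_U_b :: "'a U_b \<Rightarrow> 'a U_b \<Rightarrow> 'a U_b" is "\<lambda>f g x. f x + g x"
  by (rule ubfun_add)

lift_definition scaleR_U_b :: "real \<Rightarrow> 'a U_b \<Rightarrow> 'a U_b" is "\<lambda>c f x. c * f x"
  by (rule ubfun_scale)

lift_definition uminus_U_b :: "'a U_b \<Rightarrow> 'a U_b" is "\<lambda>f x. - f x"
  using ubfun_scale[of _ "-1"] by simp

lift_definition minus_U_b :: "'a U_b \<Rightarrow> 'a U_b \<Rightarrow> 'a U_b" is "\<lambda>f g x. f x - g x"
  using ubfun_add ubfun_scale[of _ "-1"] by fastforce

instance
proof
  fix f g h :: "'a U_b" and a b :: real
  show "f + g + h = f + (g + h)" by transfer (simp add: add.assoc)
  show "f + g = g + f" by transfer (simp add: add.commute)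
  show "0 + f = f" by transfer simp
  show "- f + f = 0" by transfer simp
  show "f - g = f + - g" by transfer simp
  show "a *\<^sub>R (f + g) = a *\<^sub>R f + a *\<^sub>R g" by transfer (simp add: algebra_simps)
  show "(a + b) *\<^sub>R f = a *\<^sub>R f + b *\<^sub>R f" by transfer (simp add: algebra_simps)
  show "a *\<^sub>R b *\<^sub>R f = (a * b) *\<^sub>R f" by transfer (simp add: algebra_simps)
  show "1 *\<^sub>R f = f" by transfer simp
qed

end

instantiation U_b :: (uniform_space) real_normed_vector
begin

lift_definition norm_U_b :: "'a U_b \<Rightarrow> real" is "\<lambda>f. SUP x. \<bar>f x\<bar>" .

definition dist_U_b :: "'a U_b \<Rightarrow> 'a U_b \<Rightarrow> real"
  where "dist_U_b f g = norm (f - g)"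

definition sgn_U_b :: "'a U_b \<Rightarrow> 'a U_b"
  where "sgn_U_b f = f /\<^sub>R norm f"

definition uniformity_U_b :: "('a U_b \<times> 'a U_b) filter"
  where "uniformity_U_b = (INF e\<in>{0 <..}. principal {(x, y). dist x y < e})"

definition open_U_b :: "'a U_b set \<Rightarrow> bool"
  where "open_U_b S = (\<forall>x\<in>S. \<forall>\<^sub>F (x', y) in uniformity. x' = x \<longrightarrow> y \<in> S)"

lemma abs_apply_U_b_le_norm: "\<bar>apply_U_b f x\<bar> \<le> norm (f :: 'a U_b)"
proof transfer
  fix f :: "'a \<Rightarrow> real" and x assume "f \<in> ubfun"
  then obtain B where "\<And>x. \<bar>f x\<bar> \<le> B" using ubfun_bound by blast
  then show "\<bar>f x\<bar> \<le> (SUP x. \<bar>f x\<bar>)" by (intro cSUP_upper bdd_aboveI2) auto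
qed

lemma norm_U_b_le: "(\<And>x. \<bar>apply_U_b f x\<bar> \<le> B) \<Longrightarrow> norm (f :: 'a U_b) \<le> B"
  by transfer (auto intro: cSUP_least)

instance
proof
  fix f g h :: "'a U_b" and a b :: real
  show "dist f g = norm (f - g)" by (rule dist_U_b_def)
  show "sgn f = f /\<^sub>R norm f" by (rule sgn_U_b_def)
  show "(uniformity :: ('a U_b \<times> 'a U_b) filter) = (INF e\<in>{0 <..}. principal {(x, y). dist x y < e})"
    by (rule uniformity_U_b_def)
  show "open U = (\<forall>x\<in>U. \<forall>\<^sub>F (x', y) in uniformity. x' = x \<longrightarrow> y \<in> U)" for U :: "'a U_b set"
    by (rule open_U_b_def)
  show "norm f = 0 \<longleftrightarrow> f = 0"
  proof
    assume "norm f = 0"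
    then have "apply_U_b f x = 0" for x
      using abs_apply_U_b_le_norm[of f x] by simp
    then show "f = 0" by transfer auto
  next
    assume "f = 0"
    then show "norm f = 0" by simp (transfer, simp)
  qed
  show "norm (f + g) \<le> norm f + norm g"
  proof (rule norm_U_b_le)
    fix x
    show "\<bar>apply_U_b (f + g) x\<bar> \<le> norm f + norm g"
      using abs_apply_U_b_le_norm[of f x] abs_apply_U_b_le_norm[of g x]
      by (simp add: plus_U_b.rep_eq)
  qed
  have le: "norm (c *\<^sub>R k) \<le> \<bar>c\<bar> * norm k" for c and k :: "'a U_b"
    by (rule norm_U_b_le)
      (simp add: scaleR_U_b.rep_eq abs_mult mult_left_mono abs_apply_U_b_le_norm)
  show "norm (a *\<^sub>R f) = \<bar>a\<bar> * norm f"
  proof (cases "a = 0")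
    case True
    moreover have "norm (0 :: 'a U_b) = 0" by transfer simp
    moreover have "0 *\<^sub>R f = 0" by transfer simp
    ultimately show ?thesis by simp
  next
    case False
    have "inverse a *\<^sub>R a *\<^sub>R f = f" using False by transfer simp
    then have "norm f \<le> \<bar>inverse a\<bar> * norm (a *\<^sub>R f)" using le[of "inverse a" "a *\<^sub>R f"] by simp
    then have "\<bar>a\<bar> * norm f \<le> norm (a *\<^sub>R f)" using False by (simp add: field_simps)
    with le[of a f] show ?thesis by simp
  qed
qed

end

section \<open>The norm dual and its subspaces\<close>

type_synonym 'z M = "'z U_b \<Rightarrow>\<^sub>L real"

text \<open>The function space carries the product topology, so this is the coarsest
  topology for which all evaluations \<open>\<mu> \<mapsto> \<mu> f\<close> are continuous.\<close>

definition weak_star_topology :: "('z::uniform_space M) topology"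
  where "weak_star_topology = pullback_topology UNIV blinfun_apply euclidean"

definition uc_pseudometric :: "('z::uniform_space \<Rightarrow> 'z \<Rightarrow> real) \<Rightarrow> bool"
  where "uc_pseudometric \<Delta> \<longleftrightarrow>
    (\<forall>x y. 0 \<le> \<Delta> x y) \<and> (\<forall>x. \<Delta> x x = 0) \<and> (\<forall>x y. \<Delta> x y = \<Delta> y x) \<and>
    (\<forall>x y z. \<Delta> x z \<le> \<Delta> x y + \<Delta> y z) \<and>
    uniformly_continuous_on UNIV (\<lambda>(x, y). \<Delta> x y)"

definition Lip :: "('z \<Rightarrow> 'z \<Rightarrow> real) \<Rightarrow> ('z \<Rightarrow> real) set"
  where "Lip \<Delta> = {f. (\<forall>z. f z \<in> {-1..1}) \<and> (\<forall>z z'. \<bar>f z - f z'\<bar> \<le> \<Delta> z z')}"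

lemma Lip_subset_ubfun:
  fixes \<Delta> :: "'z::uniform_space \<Rightarrow> 'z \<Rightarrow> real"
  assumes "uc_pseudometric \<Delta>"
  shows "Lip \<Delta> \<subseteq> ubfun"
proof
  fix f assume f: "f \<in> Lip \<Delta>"
  show "f \<in> ubfun"
  proof (rule ubfunI[where B = 1])
    show "\<bar>f x\<bar> \<le> 1" for x using f by (auto simp: Lip_def abs_le_iff)
    fix e :: real assume e: "e > 0"
    have "uniformly_continuous_on UNIV (\<lambda>p. \<Delta> (fst p) (snd p))"
      using assms by (simp add: uc_pseudometric_def case_prod_unfold)
    with e have "\<forall>\<^sub>F p in uniformity.
        \<bar>\<Delta> (fst (fst p)) (snd (fst p)) - \<Delta> (fst (snd p)) (snd (snd p))\<bar> < e"
      by (simp add: uniformly_continuous_real_iff)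
    then obtain P Q where P: "eventually P uniformity" and Q: "eventually Q uniformity"
      and PQ: "\<And>x x' y y'. P (x, x') \<Longrightarrow> Q (y, y') \<Longrightarrow> \<bar>\<Delta> x y - \<Delta> x' y'\<bar> < e"
      by (fastforce simp: uniformity_prod_def eventually_filtermap case_prod_unfold
          eventually_prod_filter)
    from P show "\<forall>\<^sub>F p in uniformity. \<bar>f (fst p) - f (snd p)\<bar> < e"
    proof eventually_elim
      case (elim p)
      obtain x x' where p: "p = (x, x')" by (cases p)
      have "Q (x', x')" using Q by (rule uniformity_refl)
      with elim p have "\<bar>\<Delta> x x' - \<Delta> x' x'\<bar> < e" using PQ by blast
      moreover have "\<bar>f x - f x'\<bar> \<le> \<Delta> x x'" using f by (auto simp: Lip_def)
      moreover have "\<Delta> x' x' = 0" using assms by (simp add: uc_pseudometric_def)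
      ultimately show ?case using p by simp
    qed
  qed
qed

text \<open>\<open>Lip \<Delta>\<close> has the topology of pointwise convergence, which is the subspace
  topology inherited from \<open>'z \<Rightarrow> real\<close>. By \<open>Lip_subset_ubfun\<close>, only values of
  \<open>Abs_U_b\<close> at elements of \<open>ubfun\<close> matter here.\<close>

definition M_u :: "('z::uniform_space M) set"
  where "M_u = {\<mu>. \<forall>\<Delta>. uc_pseudometric \<Delta> \<longrightarrow>
    continuous_on (Lip \<Delta>) (\<lambda>f. blinfun_apply \<mu> (Abs_U_b f))}"

lift_definition dirac :: "'z::uniform_space \<Rightarrow> 'z M" is "\<lambda>z f. apply_U_b f z"
  by (rule bounded_linear_intro[where K = 1])
    (auto simp: plus_U_b.rep_eq scaleR_U_b.rep_eq abs_apply_U_b_le_norm)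

definition Mol :: "('z::uniform_space M) set"
  where "Mol = span (range dirac)"

definition M_pos :: "('z::uniform_space M) set"
  where "M_pos = {\<mu>. \<forall>f. (\<forall>z. 0 \<le> apply_U_b f z) \<longrightarrow> 0 \<le> blinfun_apply \<mu> f}"

definition Mol_pos :: "('z::uniform_space M) set"
  where "Mol_pos = Mol \<inter> M_pos"

definition M_u_pos :: "('z::uniform_space M) set"
  where "M_u_pos = M_u \<inter> M_pos"

definition uniform_compactification :: "('z::uniform_space M) set"
  where "uniform_compactification = weak_star_topology closure_of range dirac"

definition uniform_completion :: "('z::uniform_space M) set"
  where "uniform_completion = uniform_compactification \<inter> M_u"

section \<open>Semiuniform actions and convolution\<close>

definition uniformly_equicontinuous :: "('a::uniform_space \<Rightarrow> 'b::uniform_space) set \<Rightarrow> bool"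
  where "uniformly_equicontinuous G \<longleftrightarrow>
    (\<forall>E. eventually E uniformity \<longrightarrow>
      (\<forall>\<^sub>F (x, x') in uniformity. \<forall>g\<in>G. E (g x, g x')))"

text \<open>Nothing is assumed to relate the multiplication and the uniformity of \<open>'x\<close>.\<close>

definition semiuniform_action ::
    "('x::{semigroup_mult, uniform_space} \<Rightarrow> 'y::uniform_space \<Rightarrow> 'y) \<Rightarrow> bool"
  where "semiuniform_action m \<longleftrightarrow>
    (\<forall>s s' y. m s (m s' y) = m (s * s') y) \<and>
    uniformly_equicontinuous {\<lambda>x. m x y | y. True} \<and>
    (\<forall>x. uniformly_continuous_on UNIV (\<lambda>y. m x y))"

definition convolution ::
    "('x::uniform_space \<Rightarrow> 'y::uniform_space \<Rightarrow> 'y) \<Rightarrow> 'x M \<Rightarrow> 'y M \<Rightarrow> 'y M"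
  where "convolution m \<mu> \<nu> =
    Blinfun (\<lambda>f. blinfun_apply \<mu>
      (Abs_U_b (\<lambda>x. blinfun_apply \<nu> (Abs_U_b (\<lambda>y. apply_U_b f (m x y))))))"

text \<open>The next lemmas show that, for a semiuniform action, the arguments of \<open>Abs_U_b\<close>
  and \<open>Blinfun\<close> in the definition of \<open>convolution\<close> are legitimate.\<close>

lemma action_section_ubfun:
  assumes "semiuniform_action m"
  shows "(\<lambda>y. apply_U_b f (m x y)) \<in> ubfun"
proof -
  have "uniformly_continuous_on UNIV (\<lambda>y. m x y)"
    using assms by (simp add: semiuniform_action_def)
  moreover have "uniformly_continuous_on (range (m x)) (apply_U_b f)"
    using apply_U_b[of f] unfolding ubfun_def uniformly_continuous_on_uniformity
    by (auto elim!: filterlim_mono simp: le_infI1)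
  ultimately have "uniformly_continuous_on UNIV (\<lambda>y. apply_U_b f (m x y))"
    by (rule uniformly_continuous_on_compose)
  then show ?thesis
    using abs_apply_U_b_le_norm[of f] by (auto simp: ubfun_def bounded_iff)
qed

lemma action_integral_ubfun:
  assumes m: "semiuniform_action m"
  shows "(\<lambda>x. blinfun_apply \<nu> (Abs_U_b (\<lambda>y. apply_U_b f (m x y)))) \<in> ubfun"
proof (rule ubfunI)
  let ?F = "\<lambda>x. Abs_U_b (\<lambda>y. apply_U_b f (m x y))"
  have F: "apply_U_b (?F x) y = apply_U_b f (m x y)" for x y
    by (simp add: Abs_U_b_inverse action_section_ubfun[OF m])
  have "norm (?F x) \<le> norm f" for x
    by (rule norm_U_b_le) (simp add: F abs_apply_U_b_le_norm)
  then show "\<bar>blinfun_apply \<nu> (?F x)\<bar> \<le> norm \<nu> * norm f" for x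
    using norm_blinfun[of \<nu> "?F x"] mult_left_mono[OF _ norm_ge_zero[of \<nu>], of "norm (?F x)" "norm f"]
    by fastforce
  fix e :: real assume e: "e > 0"
  define d where "d = e / (norm \<nu> + 1)"
  have d: "d > 0" using e by (simp add: d_def add_nonneg_pos)
  have "\<forall>\<^sub>F p in uniformity. \<bar>apply_U_b f (fst p) - apply_U_b f (snd p)\<bar> < d"
    using apply_U_b d by (rule ubfunD)
  moreover have "uniformly_equicontinuous {\<lambda>x. m x y | y. True}"
    using m by (simp add: semiuniform_action_def)
  ultimately have "\<forall>\<^sub>F (x, x') in uniformity. \<forall>g\<in>{\<lambda>x. m x y | y. True}.
      \<bar>apply_U_b f (g x) - apply_U_b f (g x')\<bar> < d"
    unfolding uniformly_equicontinuous_def by fastforce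
  then show "\<forall>\<^sub>F p in uniformity. \<bar>blinfun_apply \<nu> (?F (fst p)) - blinfun_apply \<nu> (?F (snd p))\<bar> < e"
  proof eventually_elim
    case (elim p)
    obtain x x' where p: "p = (x, x')" by (cases p)
    have "\<bar>apply_U_b f (m x y) - apply_U_b f (m x' y)\<bar> < d" for y
      using elim p by auto
    then have "norm (?F x - ?F x') \<le> d"
      by (intro norm_U_b_le) (simp add: minus_U_b.rep_eq F less_imp_le)
    then have "norm \<nu> * norm (?F x - ?F x') \<le> norm \<nu> * d" by (simp add: mult_left_mono)
    moreover have "norm \<nu> * d < e"
    proof -
      have "(norm \<nu> + 1) * d = e"
        using norm_ge_zero[of \<nu>] by (simp add: d_def add_nonneg_eq_0_iff)
      then show ?thesis using d by (simp add: distrib_right)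
    qed
    moreover have "\<bar>blinfun_apply \<nu> (?F x - ?F x')\<bar> \<le> norm \<nu> * norm (?F x - ?F x')"
      using norm_blinfun[of \<nu>] by simp
    ultimately show ?case using p by (simp add: blinfun.diff_right)
  qed
qed

lemma convolution_apply:
  assumes m: "semiuniform_action m"
  shows "blinfun_apply (convolution m \<mu> \<nu>) f =
    blinfun_apply \<mu> (Abs_U_b (\<lambda>x. blinfun_apply \<nu> (Abs_U_b (\<lambda>y. apply_U_b f (m x y)))))"
proof -
  let ?F = "\<lambda>f x. Abs_U_b (\<lambda>y. apply_U_b f (m x y))"
  let ?G = "\<lambda>f. Abs_U_b (\<lambda>x. blinfun_apply \<nu> (?F f x))"
  have F: "apply_U_b (?F f x) y = apply_U_b f (m x y)" for f x y
    by (simp add: Abs_U_b_inverse action_section_ubfun[OF m])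
  have G: "apply_U_b (?G f) x = blinfun_apply \<nu> (?F f x)" for f x
    by (simp add: Abs_U_b_inverse action_integral_ubfun[OF m])
  have Fadd: "?F (f + g) x = ?F f x + ?F g x" for f g x
    by (rule apply_U_b_inject[THEN iffD1]) (rule ext, simp only: F, simp only: plus_U_b.rep_eq F)
  have Fscale: "?F (c *\<^sub>R f) x = c *\<^sub>R ?F f x" for c f x
    by (rule apply_U_b_inject[THEN iffD1]) (rule ext, simp only: F, simp only: scaleR_U_b.rep_eq F)
  have Gadd: "?G (f + g) = ?G f + ?G g" for f g
  proof (rule apply_U_b_inject[THEN iffD1], rule ext)
    fix x
    have "apply_U_b (?G (f + g)) x = blinfun_apply \<nu> (?F (f + g) x)" by (rule G)
    also have "\<dots> = blinfun_apply \<nu> (?F f x) + blinfun_apply \<nu> (?F g x)" by (simp only: Fadd blinfun.add_right)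
    also have "\<dots> = apply_U_b (?G f + ?G g) x" by (simp only: plus_U_b.rep_eq G)
    finally show "apply_U_b (?G (f + g)) x = apply_U_b (?G f + ?G g) x" .
  qed
  have Gscale: "?G (c *\<^sub>R f) = c *\<^sub>R ?G f" for c f
  proof (rule apply_U_b_inject[THEN iffD1], rule ext)
    fix x
    have "apply_U_b (?G (c *\<^sub>R f)) x = blinfun_apply \<nu> (?F (c *\<^sub>R f) x)" by (rule G)
    also have "\<dots> = c * blinfun_apply \<nu> (?F f x)" by (simp only: Fscale blinfun.scaleR_right real_scaleR_def)
    also have "\<dots> = apply_U_b (c *\<^sub>R ?G f) x" by (simp only: scaleR_U_b.rep_eq G)
    finally show "apply_U_b (?G (c *\<^sub>R f)) x = apply_U_b (c *\<^sub>R ?G f) x" .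
  qed
  have Fn: "norm (?F f x) \<le> norm f" for f x
    by (rule norm_U_b_le) (simp add: F abs_apply_U_b_le_norm)
  have Gn: "norm (?G f) \<le> norm \<nu> * norm f" for f
  proof (rule norm_U_b_le)
    fix x
    show "\<bar>apply_U_b (?G f) x\<bar> \<le> norm \<nu> * norm f"
      unfolding G using norm_blinfun[of \<nu> "?F f x"] mult_left_mono[OF Fn[of f x] norm_ge_zero[of \<nu>]]
      by simp
  qed
  have "bounded_linear (\<lambda>f. blinfun_apply \<mu> (?G f))"
  proof (rule bounded_linear_intro[where K = "norm \<mu> * norm \<nu>"])
    show "norm (blinfun_apply \<mu> (?G f)) \<le> norm f * (norm \<mu> * norm \<nu>)" for f
      using norm_blinfun[of \<mu> "?G f"] mult_left_mono[OF Gn[of f] norm_ge_zero[of \<mu>]]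
      by (simp add: algebra_simps)
  qed (simp_all only: Gadd Gscale blinfun.add_right blinfun.scaleR_right)
  then show ?thesis
    by (simp add: convolution_def bounded_linear_Blinfun_apply)
qed

end

theory Submission
  imports Defs
begin

text \<open>
  Write \<open>f\<^sub>x = f \<circ> m x\<close> for the translate of a function \<open>f\<close> on \<open>Y\<close>, and let
  \<open>(\<nu> \<bullet> f) x = \<nu> f\<^sub>x\<close>, so that \<open>(\<mu> \<star> \<nu>) f = \<mu> (\<nu> \<bullet> f)\<close>. Positivity passes from \<open>f\<close> to
  \<open>f\<^sub>x\<close>, to \<open>\<nu> \<bullet> f\<close> and to \<open>\<mu> (\<nu> \<bullet> f)\<close>. For molecular measures, convolution is bilinear
  and satisfies \<open>\<delta>\<^sub>x \<star> \<delta>\<^sub>y = \<delta>\<^bsub>m x y\<^esub>\<close>.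

  For the compactification, two one-sided continuity properties suffice: for the weak*
  topology \<open>\<mu> \<mapsto> \<mu> \<star> \<nu>\<close> is continuous for every \<open>\<nu>\<close>, while \<open>\<nu> \<mapsto> \<mu> \<star> \<nu>\<close> is continuous
  when \<open>\<mu>\<close> is a point mass. Hence \<open>\<delta>\<^sub>x \<star> \<nu>\<close> is a limit of point masses when \<open>\<nu>\<close> is,
  and then so is \<open>\<mu> \<star> \<nu>\<close>.

  For uniform measures, fix a uniformly continuous pseudometric \<open>\<Delta>\<close> on \<open>Y\<close>. The translates
  by one \<open>x\<close> of functions in \<open>Lip \<Delta>\<close> lie in \<open>Lip \<Delta>\<^sub>x\<close> for the pseudometric
  \<open>\<Delta>\<^sub>x y y' = \<Delta> (m x y) (m x y')\<close>, so \<open>f \<mapsto> (\<nu> \<bullet> f) x\<close> is continuous on \<open>Lip \<Delta>\<close> because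
  \<open>\<nu>\<close> is uniform. Equicontinuity of the action makes
  \<open>\<Delta>' x x' = (SUP y. min 2 (\<Delta> (m x y) (m x' y)))\<close> a uniformly continuous pseudometric on \<open>X\<close>,
  and up to the constant factor \<open>\<parallel>\<nu>\<parallel> + 1\<close> every \<open>\<nu> \<bullet> f\<close> with \<open>f \<in> Lip \<Delta>\<close> lies in
  \<open>Lip \<Delta>'\<close>. Thus \<open>f \<mapsto> \<nu> \<bullet> f\<close> is, up to scaling, a pointwise continuous map
  \<open>Lip \<Delta> \<rightarrow> Lip \<Delta>'\<close>, and \<open>\<mu>\<close> is continuous on \<open>Lip \<Delta>'\<close>.

  The remaining classes are intersections of two of the previous ones.
\<close>

section \<open>Translates and partial integrals\<close>

definition translate ::
    "('x::{semigroup_mult, uniform_space} \<Rightarrow> 'y::uniform_space \<Rightarrow> 'y) \<Rightarrow> 'x \<Rightarrow> 'y U_b \<Rightarrow> 'y U_b"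
  where "translate m x f = Abs_U_b (\<lambda>y. apply_U_b f (m x y))"

definition partial_integral ::
    "('x::{semigroup_mult, uniform_space} \<Rightarrow> 'y::uniform_space \<Rightarrow> 'y) \<Rightarrow> 'y M \<Rightarrow> 'y U_b \<Rightarrow> 'x U_b"
  where "partial_integral m \<nu> f = Abs_U_b (\<lambda>x. blinfun_apply \<nu> (translate m x f))"

lemma U_b_eqI: "(\<And>x. apply_U_b f x = apply_U_b g x) \<Longrightarrow> f = g"
  by (metis apply_U_b_inject ext)

lemma apply_translate:
  assumes "semiuniform_action m"
  shows "apply_U_b (translate m x f) y = apply_U_b f (m x y)"
  by (simp add: translate_def Abs_U_b_inverse action_section_ubfun[OF assms])

lemma apply_partial_integral:
  assumes "semiuniform_action m"
  shows "apply_U_b (partial_integral m \<nu> f) x = blinfun_apply \<nu> (translate m x f)"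
  by (simp add: partial_integral_def translate_def Abs_U_b_inverse action_integral_ubfun[OF assms])

lemma convolution_eq_partial_integral:
  assumes "semiuniform_action m"
  shows "blinfun_apply (convolution m \<mu> \<nu>) f = blinfun_apply \<mu> (partial_integral m \<nu> f)"
  by (simp add: convolution_apply[OF assms] partial_integral_def translate_def)

lemma partial_integral_add:
  assumes "semiuniform_action m"
  shows "partial_integral m (\<nu> + \<nu>') f = partial_integral m \<nu> f + partial_integral m \<nu>' f"
  by (rule U_b_eqI)
    (simp add: apply_partial_integral[OF assms] plus_U_b.rep_eq blinfun.add_left)

lemma partial_integral_scaleR:
  assumes "semiuniform_action m"
  shows "partial_integral m (c *\<^sub>R \<nu>) f = c *\<^sub>R partial_integral m \<nu> f"
  by (rule U_b_eqI)
    (simp add: apply_partial_integral[OF assms] scaleR_U_b.rep_eq blinfun.scaleR_left)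

section \<open>Positive and molecular measures\<close>

lemma convolution_M_pos:
  assumes "semiuniform_action m" and "\<mu> \<in> M_pos" and "\<nu> \<in> M_pos"
  shows "convolution m \<mu> \<nu> \<in> M_pos"
  using assms
  by (simp add: M_pos_def convolution_eq_partial_integral apply_partial_integral apply_translate)

lemma bilinear_convolution:
  assumes "semiuniform_action m"
  shows "bilinear (convolution m)"
  by (auto simp: bilinear_def convolution_eq_partial_integral[OF assms]
      partial_integral_add[OF assms] partial_integral_scaleR[OF assms]
      blinfun.add_left blinfun.add_right blinfun.scaleR_left blinfun.scaleR_right
      intro!: linearI blinfun_eqI)

lemma convolution_dirac_dirac:
  assumes "semiuniform_action m"
  shows "convolution m (dirac x) (dirac y) = dirac (m x y)"
  by (rule blinfun_eqI)
    (simp add: convolution_eq_partial_integral[OF assms] dirac.rep_eq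
      apply_partial_integral[OF assms] apply_translate[OF assms])

lemma convolution_Mol:
  assumes m: "semiuniform_action m" and \<mu>: "\<mu> \<in> Mol" and \<nu>: "\<nu> \<in> Mol"
  shows "convolution m \<mu> \<nu> \<in> Mol"
proof -
  have subspace: "subspace (Mol :: 'b M set)"
    unfolding Mol_def by (rule subspace_span)
  have right: "linear (convolution m \<mu>')" and left: "linear (\<lambda>\<mu>. convolution m \<mu> \<nu>')" for \<mu>' \<nu>'
    using bilinear_convolution[OF m] by (simp_all add: bilinear_def)
  have dirac: "convolution m (dirac x) \<nu> \<in> Mol" for x
    using \<nu>[unfolded Mol_def]
  proof (rule span_induct[where P = "\<lambda>\<nu>. convolution m (dirac x) \<nu> \<in> Mol"])
    show "subspace {\<nu>. convolution m (dirac x) \<nu> \<in> Mol}"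
      using linear_subspace_vimage[OF right subspace] by (simp add: vimage_def)
    show "convolution m (dirac x) \<nu> \<in> Mol" if "\<nu> \<in> range dirac" for \<nu>
      using that by (auto simp: convolution_dirac_dirac[OF m] Mol_def intro: span_base)
  qed
  show ?thesis
    using \<mu>[unfolded Mol_def]
  proof (rule span_induct[where P = "\<lambda>\<mu>. convolution m \<mu> \<nu> \<in> Mol"])
    show "subspace {\<mu>. convolution m \<mu> \<nu> \<in> Mol}"
      using linear_subspace_vimage[OF left subspace] by (simp add: vimage_def)
  qed (use dirac in auto)
qed

section \<open>The uniform compactification\<close>

text \<open>On a dual space the weak* topology is the strong operator topology of functionals.\<close>

lemma weak_star_topology_eq_strong_operator:
  "weak_star_topology = strong_operator_topology"
  by (simp add: weak_star_topology_def strong_operator_topology_def)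

lemma continuous_map_weak_star_apply:
  "continuous_map weak_star_topology euclidean (\<lambda>\<mu>. blinfun_apply \<mu> f)"
  unfolding weak_star_topology_eq_strong_operator
  by (rule strong_operator_topology_continuous_evaluation)

lemma continuous_map_into_weak_star:
  assumes "\<And>f. continuous_map X euclidean (\<lambda>x. blinfun_apply (T x) f)"
  shows "continuous_map X weak_star_topology T"
  using assms
  by (simp add: weak_star_topology_eq_strong_operator
      continuous_on_strong_operator_topo_iff_coordinatewise)

text \<open>The inner limit is taken in \<open>\<nu>\<close>, with a point mass on the left, and the outer one in \<open>\<mu>\<close>:
  continuity in \<open>\<nu>\<close> is available only for point masses on the left.\<close>

lemma convolution_uniform_compactification:
  assumes m: "semiuniform_action m"
    and \<mu>: "\<mu> \<in> uniform_compactification" and \<nu>: "\<nu> \<in> uniform_compactification"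
  shows "convolution m \<mu> \<nu> \<in> uniform_compactification"
proof -
  have left: "continuous_map weak_star_topology weak_star_topology (\<lambda>\<mu>. convolution m \<mu> \<nu>)"
    by (rule continuous_map_into_weak_star)
      (simp add: convolution_eq_partial_integral[OF m] continuous_map_weak_star_apply)
  have right: "continuous_map weak_star_topology weak_star_topology (convolution m (dirac x))" for x
    by (rule continuous_map_into_weak_star)
      (simp add: convolution_eq_partial_integral[OF m] dirac.rep_eq
        apply_partial_integral[OF m] continuous_map_weak_star_apply)
  have dirac: "convolution m (dirac x) \<nu> \<in> uniform_compactification" for x
  proof -
    have "convolution m (dirac x) \<nu> \<in> weak_star_topology closure_of (convolution m (dirac x) ` range dirac)"
      using continuous_map_image_closure_subset[OF right] \<nu>
      unfolding uniform_compactification_def by blast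
    moreover have "convolution m (dirac x) ` range dirac \<subseteq> range dirac"
      by (auto simp: convolution_dirac_dirac[OF m])
    ultimately show ?thesis
      unfolding uniform_compactification_def using closure_of_mono by blast
  qed
  have "convolution m \<mu> \<nu> \<in> weak_star_topology closure_of ((\<lambda>\<mu>. convolution m \<mu> \<nu>) ` range dirac)"
    using continuous_map_image_closure_subset[OF left] \<mu>
    unfolding uniform_compactification_def by blast
  moreover have "weak_star_topology closure_of ((\<lambda>\<mu>. convolution m \<mu> \<nu>) ` range dirac)
      \<subseteq> uniform_compactification"
    using dirac unfolding uniform_compactification_def
    by (intro closure_of_minimal) auto
  ultimately show ?thesis by blast
qed

section \<open>Uniform measures\<close>

text \<open>The triangle inequality gives \<open>\<bar>\<Delta> x y - \<Delta> x' y'\<bar> \<le> \<Delta> x x' + \<Delta> y y'\<close>, so smallness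
  near the diagonal is all that joint uniform continuity requires.\<close>

lemma uc_pseudometricI:
  assumes nonneg: "\<And>x y. 0 \<le> \<Delta> x y" and refl: "\<And>x. \<Delta> x x = 0"
    and sym: "\<And>x y. \<Delta> x y = \<Delta> y x" and tri: "\<And>x y z. \<Delta> x z \<le> \<Delta> x y + \<Delta> y z"
    and small: "\<And>e. e > 0 \<Longrightarrow> \<forall>\<^sub>F p in uniformity. \<Delta> (fst p) (snd p) < e"
  shows "uc_pseudometric \<Delta>"
proof -
  have "\<forall>\<^sub>F p in uniformity. \<bar>\<Delta> (fst (fst p)) (snd (fst p)) - \<Delta> (fst (snd p)) (snd (snd p))\<bar> < e"
    if "e > 0" for e
  proof -
    have "\<forall>\<^sub>F p in uniformity. \<Delta> (fst p) (snd p) < e / 2"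
      using small[of "e / 2"] \<open>e > 0\<close> by simp
    then have "\<forall>\<^sub>F q in uniformity \<times>\<^sub>F uniformity.
        \<Delta> (fst (fst q)) (snd (fst q)) < e / 2 \<and> \<Delta> (fst (snd q)) (snd (snd q)) < e / 2"
      unfolding eventually_prod_filter by fastforce
    then show ?thesis
      unfolding uniformity_prod_def eventually_filtermap
    proof eventually_elim
      case (elim q)
      obtain x x' y y' where q: "q = ((x, x'), (y, y'))" by (metis prod.collapse)
      have "\<Delta> x x' < e / 2" "\<Delta> y y' < e / 2" using elim q by auto
      moreover have "\<Delta> x y \<le> \<Delta> x x' + \<Delta> x' y" "\<Delta> x' y \<le> \<Delta> x' y' + \<Delta> y' y"
        "\<Delta> x' y' \<le> \<Delta> x' x + \<Delta> x y'" "\<Delta> x y' \<le> \<Delta> x y + \<Delta> y y'"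
        by (rule tri)+
      ultimately show ?case
        using sym[of x x'] sym[of y y'] q by (simp add: abs_less_iff)
    qed
  qed
  then show ?thesis
    unfolding uc_pseudometric_def uniformly_continuous_real_iff case_prod_unfold
    using nonneg refl sym tri by blast
qed

text \<open>Smallness near the diagonal comes from joint uniform continuity by comparing the pair
  \<open>(x, x')\<close> with \<open>(x', x')\<close>, where \<open>\<Delta>\<close> vanishes.\<close>

lemma uc_pseudometric_small:
  assumes "uc_pseudometric \<Delta>" and e: "e > 0"
  shows "\<forall>\<^sub>F p in uniformity. \<Delta> (fst p) (snd p) < e"
proof -
  have "uniformly_continuous_on UNIV (\<lambda>p. \<Delta> (fst p) (snd p))"
    using assms by (simp add: uc_pseudometric_def case_prod_unfold)
  with e have "\<forall>\<^sub>F p in uniformity.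
      \<bar>\<Delta> (fst (fst p)) (snd (fst p)) - \<Delta> (fst (snd p)) (snd (snd p))\<bar> < e"
    by (simp add: uniformly_continuous_real_iff)
  then obtain P Q where P: "eventually P uniformity" and Q: "eventually Q uniformity"
    and PQ: "\<And>x x' y y'. P (x, x') \<Longrightarrow> Q (y, y') \<Longrightarrow> \<bar>\<Delta> x y - \<Delta> x' y'\<bar> < e"
    by (fastforce simp: uniformity_prod_def eventually_filtermap case_prod_unfold
        eventually_prod_filter)
  from P show ?thesis
  proof eventually_elim
    case (elim p)
    have "Q (snd p, snd p)" using Q by (rule uniformity_refl)
    with elim have "\<bar>\<Delta> (fst p) (snd p) - \<Delta> (snd p) (snd p)\<bar> < e"
      using PQ by (metis prod.collapse)
    then show ?case using assms by (simp add: uc_pseudometric_def)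
  qed
qed

lemma uc_pseudometric_pullback:
  assumes \<Delta>: "uc_pseudometric \<Delta>" and h: "uniformly_continuous_on UNIV h"
  shows "uc_pseudometric (\<lambda>y y'. \<Delta> (h y) (h y'))"
proof (rule uc_pseudometricI)
  show "\<forall>\<^sub>F p in uniformity. \<Delta> (h (fst p)) (h (snd p)) < e" if "e > 0" for e
    using uniformly_continuous_onD[OF h uc_pseudometric_small[OF \<Delta> that]]
    by (simp add: case_prod_unfold)
qed (use \<Delta> in \<open>auto simp: uc_pseudometric_def\<close>)

text \<open>Truncation makes the supremum finite. The level 2 is harmless because functions in
  \<open>Lip \<Delta>\<close> take values in an interval of length 2.\<close>

definition orbit_pseudometric :: "('x \<Rightarrow> 'y \<Rightarrow> 'y) \<Rightarrow> ('y \<Rightarrow> 'y \<Rightarrow> real) \<Rightarrow> 'x \<Rightarrow> 'x \<Rightarrow> real"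
  where "orbit_pseudometric m \<Delta> x x' = (SUP y. min 2 (\<Delta> (m x y) (m x' y)))"

lemma orbit_pseudometric_upper:
  "min 2 (\<Delta> (m x y) (m x' y)) \<le> orbit_pseudometric m \<Delta> x x'"
  unfolding orbit_pseudometric_def
  by (rule cSUP_upper) (auto intro: bdd_aboveI2[where M = 2])

lemma orbit_pseudometric_least:
  "(\<And>y. min 2 (\<Delta> (m x y) (m x' y)) \<le> b) \<Longrightarrow> orbit_pseudometric m \<Delta> x x' \<le> b"
  unfolding orbit_pseudometric_def by (rule cSUP_least) auto

lemma uc_orbit_pseudometric:
  assumes m: "semiuniform_action m" and \<Delta>: "uc_pseudometric \<Delta>"
  shows "uc_pseudometric (orbit_pseudometric m \<Delta>)"
proof (rule uc_pseudometricI)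
  have nonneg: "0 \<le> \<Delta> y z" and refl: "\<Delta> y y = 0" and sym: "\<Delta> y z = \<Delta> z y"
    and tri: "\<Delta> y z \<le> \<Delta> y w + \<Delta> w z" for y z w
    using \<Delta> unfolding uc_pseudometric_def by blast+
  show "0 \<le> orbit_pseudometric m \<Delta> x x'" for x x'
    using orbit_pseudometric_upper[of \<Delta> m x undefined x'] nonneg[of "m x undefined" "m x' undefined"]
    by linarith
  show "orbit_pseudometric m \<Delta> x x = 0" for x
    by (simp add: orbit_pseudometric_def refl)
  show "orbit_pseudometric m \<Delta> x x' = orbit_pseudometric m \<Delta> x' x" for x x'
    unfolding orbit_pseudometric_def by (subst sym) simp
  show "orbit_pseudometric m \<Delta> x z \<le> orbit_pseudometric m \<Delta> x y + orbit_pseudometric m \<Delta> y z"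
    for x y z
  proof (rule orbit_pseudometric_least)
    fix w
    show "min 2 (\<Delta> (m x w) (m z w)) \<le> orbit_pseudometric m \<Delta> x y + orbit_pseudometric m \<Delta> y z"
      using orbit_pseudometric_upper[of \<Delta> m x w y] orbit_pseudometric_upper[of \<Delta> m y w z]
        tri[of "m x w" "m z w" "m y w"] nonneg[of "m x w" "m y w"] nonneg[of "m y w" "m z w"]
      by linarith
  qed
  fix e :: real assume e: "e > 0"
  have "\<forall>\<^sub>F p in uniformity. \<Delta> (fst p) (snd p) < e / 2"
    using uc_pseudometric_small[OF \<Delta>, of "e / 2"] e by simp
  then have "\<forall>\<^sub>F (x, x') in uniformity. \<forall>g\<in>{\<lambda>x. m x y | y. True}. \<Delta> (g x) (g x') < e / 2"
    using m unfolding semiuniform_action_def uniformly_equicontinuous_def by fastforce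
  then show "\<forall>\<^sub>F p in uniformity. orbit_pseudometric m \<Delta> (fst p) (snd p) < e"
  proof eventually_elim
    case (elim p)
    have "\<Delta> (m (fst p) y) (m (snd p) y) < e / 2" for y
      using elim by (auto simp: case_prod_unfold)
    then have "orbit_pseudometric m \<Delta> (fst p) (snd p) \<le> e / 2"
      by (intro orbit_pseudometric_least min.coboundedI2 less_imp_le)
    then show ?case using e by linarith
  qed
qed

text \<open>Both the values and the increments of \<open>x \<mapsto> \<nu> f\<^sub>x\<close> are controlled by \<open>\<parallel>\<nu>\<parallel>\<close> times the sup
  norm of a translate or of a difference of two translates. Dividing by \<open>\<parallel>\<nu>\<parallel> + 1\<close> instead
  of \<open>\<parallel>\<nu>\<parallel>\<close> covers \<open>\<nu> = 0\<close>.\<close>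

lemma partial_integral_Lip:
  assumes m: "semiuniform_action m" and \<Delta>: "uc_pseudometric \<Delta>" and f: "f \<in> Lip \<Delta>"
  shows "(\<lambda>x. blinfun_apply \<nu> (translate m x (Abs_U_b f)) / (norm \<nu> + 1))
    \<in> Lip (orbit_pseudometric m \<Delta>)"
proof -
  let ?t = "\<lambda>x. translate m x (Abs_U_b f)"
  have t: "apply_U_b (?t x) y = f (m x y)" for x y
    using Lip_subset_ubfun[OF \<Delta>] f by (simp add: apply_translate[OF m] Abs_U_b_inverse subset_iff)
  have bound: "\<bar>blinfun_apply \<nu> g / (norm \<nu> + 1)\<bar> \<le> b" if "norm g \<le> b" for g b
  proof -
    have "\<bar>blinfun_apply \<nu> g\<bar> \<le> norm \<nu> * norm g"
      using norm_blinfun[of \<nu> g] by simp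
    also have "\<dots> \<le> (norm \<nu> + 1) * b"
      using that by (intro mult_mono) auto
    finally show ?thesis
      by (simp add: abs_divide pos_divide_le_eq add_nonneg_pos mult.commute)
  qed
  have f1: "\<bar>f y\<bar> \<le> 1" and fl: "\<bar>f y - f z\<bar> \<le> \<Delta> y z" for y z
    using f by (auto simp: Lip_def abs_le_iff)
  have 1: "norm (?t x) \<le> 1" for x
    by (rule norm_U_b_le) (simp add: t f1)
  have 2: "norm (?t x - ?t x') \<le> orbit_pseudometric m \<Delta> x x'" for x x'
  proof (rule norm_U_b_le)
    fix y
    have "\<bar>f (m x y) - f (m x' y)\<bar> \<le> min 2 (\<Delta> (m x y) (m x' y))"
      using f1[of "m x y"] f1[of "m x' y"] fl[of "m x y" "m x' y"] by linarith
    then show "\<bar>apply_U_b (?t x - ?t x') y\<bar> \<le> orbit_pseudometric m \<Delta> x x'"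
      using orbit_pseudometric_upper[of \<Delta> m x y x']
      unfolding minus_U_b.rep_eq t by (rule order_trans)
  qed
  show ?thesis
    using bound[OF 1] bound[OF 2]
    by (simp only: Lip_def mem_Collect_eq atLeastAtMost_iff blinfun.diff_right
        diff_divide_distrib abs_le_iff minus_le_iff simp_thms)
qed

text \<open>This is where uniformity of \<open>\<nu>\<close> enters: composition with \<open>m x\<close> is pointwise continuous
  from \<open>Lip \<Delta>\<close> to the Lipschitz functions of the pulled-back pseudometric.\<close>

lemma continuous_on_translate:
  assumes m: "semiuniform_action m" and \<Delta>: "uc_pseudometric \<Delta>" and \<nu>: "\<nu> \<in> M_u"
  shows "continuous_on (Lip \<Delta>) (\<lambda>f. blinfun_apply \<nu> (translate m x (Abs_U_b f)))"
proof -
  let ?D = "\<lambda>y y'. \<Delta> (m x y) (m x y')"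
  have "uc_pseudometric ?D"
    using m by (intro uc_pseudometric_pullback[OF \<Delta>]) (simp add: semiuniform_action_def)
  then have "continuous_on (Lip ?D) (\<lambda>g. blinfun_apply \<nu> (Abs_U_b g))"
    using \<nu> by (simp add: M_u_def)
  moreover have "continuous_on (Lip \<Delta>) (\<lambda>f y. f (m x y))"
    by (intro continuous_on_coordinatewise_then_product
        continuous_on_product_then_coordinatewise[OF continuous_on_id])
  moreover have "(\<lambda>f y. f (m x y)) ` Lip \<Delta> \<subseteq> Lip ?D"
    by (auto simp: Lip_def)
  ultimately have "continuous_on (Lip \<Delta>) (\<lambda>f. blinfun_apply \<nu> (Abs_U_b (\<lambda>y. f (m x y))))"
    by (rule continuous_on_compose2)
  moreover have "translate m x (Abs_U_b f) = Abs_U_b (\<lambda>y. f (m x y))" if "f \<in> Lip \<Delta>" for f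
    using that Lip_subset_ubfun[OF \<Delta>] by (simp add: translate_def Abs_U_b_inverse subset_iff)
  ultimately show ?thesis
    by (simp cong: continuous_on_cong)
qed

lemma convolution_M_u:
  assumes m: "semiuniform_action m" and \<mu>: "\<mu> \<in> M_u" and \<nu>: "\<nu> \<in> M_u"
  shows "convolution m \<mu> \<nu> \<in> M_u"
proof -
  have "continuous_on (Lip \<Delta>) (\<lambda>f. blinfun_apply (convolution m \<mu> \<nu>) (Abs_U_b f))"
    if \<Delta>: "uc_pseudometric \<Delta>" for \<Delta>
  proof -
    let ?c = "norm \<nu> + 1"
    let ?G = "\<lambda>f x. blinfun_apply \<nu> (translate m x (Abs_U_b f)) / ?c"
    have c: "?c \<noteq> 0" using norm_ge_zero[of \<nu>] by linarith
    have D: "uc_pseudometric (orbit_pseudometric m \<Delta>)"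
      by (rule uc_orbit_pseudometric[OF m \<Delta>])
    have "continuous_on (Lip (orbit_pseudometric m \<Delta>)) (\<lambda>g. blinfun_apply \<mu> (Abs_U_b g))"
      using \<mu> D by (simp add: M_u_def)
    moreover have "continuous_on (Lip \<Delta>) ?G"
      by (intro continuous_on_coordinatewise_then_product continuous_on_divide
          continuous_on_const continuous_on_translate[OF m \<Delta> \<nu>]) (use c in auto)
    moreover have "?G ` Lip \<Delta> \<subseteq> Lip (orbit_pseudometric m \<Delta>)"
      using partial_integral_Lip[OF m \<Delta>] by blast
    ultimately have "continuous_on (Lip \<Delta>) (\<lambda>f. blinfun_apply \<mu> (Abs_U_b (?G f)))"
      by (rule continuous_on_compose2)
    then have "continuous_on (Lip \<Delta>) (\<lambda>f. ?c * blinfun_apply \<mu> (Abs_U_b (?G f)))"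
      by (rule continuous_on_mult_left)
    moreover have "blinfun_apply (convolution m \<mu> \<nu>) (Abs_U_b f) =
        ?c * blinfun_apply \<mu> (Abs_U_b (?G f))" if f: "f \<in> Lip \<Delta>" for f
    proof -
      have "?G f \<in> ubfun"
        using partial_integral_Lip[OF m \<Delta> f] Lip_subset_ubfun[OF D] by blast
      then have "partial_integral m \<nu> (Abs_U_b f) = ?c *\<^sub>R Abs_U_b (?G f)"
        using c by (intro U_b_eqI)
          (simp add: apply_partial_integral[OF m] scaleR_U_b.rep_eq Abs_U_b_inverse)
      then show ?thesis
        by (simp add: convolution_eq_partial_integral[OF m] blinfun.scaleR_right)
    qed
    ultimately show ?thesis
      by (simp cong: continuous_on_cong)
  qed
  then show ?thesis by (simp add: M_u_def)
qed

section \<open>Stability of the classes of measures under convolution\<close>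

theorem theorem2p3:
  fixes m :: "'x::{semigroup_mult, uniform_space, t2_space} \<Rightarrow>
      'y::{uniform_space, t2_space} \<Rightarrow> 'y"
    and \<mu> :: "'x M" and \<nu> :: "'y M"
  assumes "semiuniform_action m"
  shows "(\<mu> \<in> M_pos \<and> \<nu> \<in> M_pos \<longrightarrow> convolution m \<mu> \<nu> \<in> M_pos) \<and>
    (\<mu> \<in> Mol \<and> \<nu> \<in> Mol \<longrightarrow> convolution m \<mu> \<nu> \<in> Mol) \<and>
    (\<mu> \<in> Mol_pos \<and> \<nu> \<in> Mol_pos \<longrightarrow> convolution m \<mu> \<nu> \<in> Mol_pos) \<and>
    (\<mu> \<in> M_u \<and> \<nu> \<in> M_u \<longrightarrow> convolution m \<mu> \<nu> \<in> M_u) \<and>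
    (\<mu> \<in> M_u_pos \<and> \<nu> \<in> M_u_pos \<longrightarrow> convolution m \<mu> \<nu> \<in> M_u_pos) \<and>
    (\<mu> \<in> uniform_compactification \<and> \<nu> \<in> uniform_compactification \<longrightarrow>
      convolution m \<mu> \<nu> \<in> uniform_compactification) \<and>
    (\<mu> \<in> uniform_completion \<and> \<nu> \<in> uniform_completion \<longrightarrow>
      convolution m \<mu> \<nu> \<in> uniform_completion)"
  using convolution_M_pos[OF assms] convolution_Mol[OF assms] convolution_M_u[OF assms]
    convolution_uniform_compactification[OF assms]
  by (simp add: Mol_pos_def M_u_pos_def uniform_completion_def)

end
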